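(* Consider the linear program $(\mathcal{P}_1)$ defined in the context, in which power cannot be exported to the grid, i.e. the constraint $P_{\rm grid}^{(t)}\ge 0$ is imposed for all $t\in\{1,\dots,N\}$. Assume $\alpha,\beta\geq 0$, $\alpha+\beta>0$, $0<\eta_c<1<\eta_d$, and $c_e^{(t)}>0$ for all $t\in\{1,\dots,N\}$. Then every feasible point of $(\mathcal{P}_1)$ for which the storage system simultaneously charges and discharges at some time, i.e. $0<P_{\rm ch}^{(t)}\leq P_{\rm ch,max}$ and $0<P_{\rm dis}^{(t)}\leq P_{\rm dis,max}$ for some $t\in\{1,\dots,N\}$, is suboptimal, i.e. is not a minimizer of $(\mathcal{P}_1)$.
   Context: Let $N\ge 1$ be an integer (prediction horizon) and $\Delta t>0$ a time step. The given real data are: prices $c_e^{(t)}$, loads $P_{\rm L,house}^{(t)}\ge 0$, and available solar power $P_{\rm sol}^{(t)}\ge 0$ for $t\in\{1,\dots,N\}$; charging and discharging power limits $P_{\rm ch,max}$ and $P_{\rm dis,max}$ (nonnegative); state-of-charge limits $E_{\rm min}\le E_{\rm max}$; initial state of charge $E^{0}$ with $E_{\rm min}\le E^0\le E_{\rm max}$; charging and discharging efficiencies $\eta_c,\eta_d$; penalty coefficients $\alpha,\beta$. The decision variables are $\underline{\mathbf{x}}_N=(\mathbf{x}^{(1)},\dots,\mathbf{x}^{(N)})\in\mathbb{R}^{4N}$ with $\mathbf{x}^{(t)}=(P_{\rm grid}^{(t)},P_{\rm ch}^{(t)},P_{\rm dis}^{(t)},P_{\rm c}^{(t)})$ (grid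 power, charging power, discharging power, curtailed solar power). The state of charge is determined by $E^{(1)}=E^0$ and $E^{(t+1)}=E^{(t)}+\eta_c\Delta t\,P_{\rm ch}^{(t)}-\eta_d\Delta t\,P_{\rm dis}^{(t)}$ for $t\in\{1,\dots,N\}$. The linear program $(\mathcal{P}_1)$ is to minimize $$f_{\rm cost}(\underline{\mathbf{x}}_N)=\sum_{t=1}^{N}\left(c_e^{(t)}P_{\rm grid}^{(t)}+\alpha P_{\rm ch}^{(t)}+\beta P_{\rm dis}^{(t)}\right)$$ over $\underline{\mathbf{x}}_N$ subject to, for all $t\in\{1,\dots,N\}$: - $0\le P_{\rm grid}^{(t)}$; - $0\le P_{\rm ch}^{(t)}\le P_{\rm ch,max}$; - $0\le P_{\rm dis}^{(t)}\le P_{\rm dis,max}$; - $E_{\rm min}\le E^{(t+1)}\le E_{\rm max}$; - $0\le P_{\rm c}^{(t)}\le P_{\rm sol}^{(t)}$; - $0=-P_{\rm grid}^{(t)}+P_{\rm L,house}^{(t)}-(P_{\rm sol}^{(t)}-P_{\rm c}^{(t)})-P_{\rm dis}^{(t)}+P_{\rm ch}^{(t)}$. *)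

theory Defs
  imports Complex_Main "HOL-Library.FuncSet"
begin

record ess_data =
  horizon :: nat
  time_step :: real
  price :: "nat \<Rightarrow> real"
  load_house :: "nat \<Rightarrow> real"
  solar :: "nat \<Rightarrow> real"
  ch_max :: real
  dis_max :: real
  E_min :: real
  E_max :: real
  E_init :: real
  eta_c :: real
  eta_d :: real
  alpha :: real
  beta :: real

definition standing_assms :: "ess_data \<Rightarrow> bool" where
  "standing_assms d \<longleftrightarrow>
     1 \<le> horizon d \<and> 0 < time_step d \<and>
     (\<forall>t\<in>{1..horizon d}. 0 \<le> load_house d t \<and> 0 \<le> solar d t) \<and>
     0 \<le> ch_max d \<and> 0 \<le> dis_max d \<and>
     E_min d \<le> E_max d \<and> E_min d \<le> E_init d \<and> E_init d \<le> E_max d"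

record decision =
  P_grid :: real
  P_ch :: real
  P_dis :: real
  P_curt :: real

(* The variables range over R^(4N): families of quadruples indexed by {1..N}, encoded as
   functions with an arbitrary fixed value outside this index set. *)
definition decision_space :: "ess_data \<Rightarrow> (nat \<Rightarrow> decision) set" where
  "decision_space d = {1..horizon d} \<rightarrow>\<^sub>E UNIV"

(* State of charge. Times start at 1; the value at 0 is a dummy. *)
primrec soc :: "ess_data \<Rightarrow> (nat \<Rightarrow> decision) \<Rightarrow> nat \<Rightarrow> real" where
  "soc d x 0 = E_init d"
| "soc d x (Suc t) =
     (if t = 0 then E_init d
      else soc d x t + eta_c d * time_step d * P_ch (x t) - eta_d d * time_step d * P_dis (x t))"

definition f_cost :: "ess_data \<Rightarrow> (nat \<Rightarrow> decision) \<Rightarrow> real" where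
  "f_cost d x =
     (\<Sum>t = 1..horizon d. price d t * P_grid (x t) + alpha d * P_ch (x t) + beta d * P_dis (x t))"

definition feasible :: "ess_data \<Rightarrow> (nat \<Rightarrow> decision) \<Rightarrow> bool" where
  "feasible d x \<longleftrightarrow>
     x \<in> decision_space d \<and>
     (\<forall>t\<in>{1..horizon d}.
        0 \<le> P_grid (x t) \<and>
        0 \<le> P_ch (x t) \<and> P_ch (x t) \<le> ch_max d \<and>
        0 \<le> P_dis (x t) \<and> P_dis (x t) \<le> dis_max d \<and>
        E_min d \<le> soc d x (t + 1) \<and> soc d x (t + 1) \<le> E_max d \<and>
        0 \<le> P_curt (x t) \<and> P_curt (x t) \<le> solar d t \<and>
        0 = - P_grid (x t) + load_house d t - (solar d t - P_curt (x t))
              - P_dis (x t) + P_ch (x t))"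

end

theory Submission
  imports Defs
begin

text \<open>
  Suppose that the storage charges and discharges at time \<open>t\<close>. It suffices to find a direction that
  decreases the cost and respects the active constraints. If \<open>P_grid (x t) > 0\<close> or
  \<open>P_curt (x t) < solar d t\<close>, lower the charging and discharging powers in the ratio
  \<open>eta_d : eta_c\<close>: no state of charge changes, and the freed power is taken from the grid power or
  added to the curtailment. Otherwise \<open>P_dis (x t) = load_house d t + P_ch (x t)\<close>; lower both powers
  equally. This raises all states of charge after \<open>t\<close>, which does no harm unless one of them is
  at \<open>E_max d\<close>. In that case the state of charge, which falls at \<open>t\<close>, rises in the step \<open>s\<close> that
  first brings it back to \<open>E_max d\<close>, and charging less at \<open>s\<close> compensates. At \<open>s\<close> the freed power
  can be absorbed, because otherwise the storage would be discharging there.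
\<close>

text \<open>Up to the factor \<open>time_step d\<close>, this is the derivative of the state of
  charge at \<open>t\<close> when charging and discharging vary in the directions \<open>a\<close>
  and \<open>b\<close>.\<close>

definition net_flow :: "ess_data \<Rightarrow> (nat \<Rightarrow> real) \<Rightarrow> (nat \<Rightarrow> real) \<Rightarrow> nat \<Rightarrow> real" where
  "net_flow d a b t = (\<Sum>s = 1..<t. eta_c d * a s - eta_d d * b s)"

definition can_absorb :: "ess_data \<Rightarrow> (nat \<Rightarrow> decision) \<Rightarrow> nat \<Rightarrow> bool" where
  "can_absorb d x t \<longleftrightarrow> 0 < P_grid (x t) \<or> P_curt (x t) < solar d t"

text \<open>The power balance must survive every step size \<epsilon>, so the imbalance
  \<open>a t - b t\<close> goes entirely into the grid power if that is positive, and into the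
  curtailment otherwise. Restricting the function to the index set keeps it in
  \<open>decision_space d\<close>.\<close>

definition shift :: "ess_data \<Rightarrow> (nat \<Rightarrow> decision) \<Rightarrow> (nat \<Rightarrow> real) \<Rightarrow> (nat \<Rightarrow> real) \<Rightarrow> real \<Rightarrow> nat \<Rightarrow> decision" where
  "shift d x a b \<epsilon> = (\<lambda>t\<in>{1..horizon d}.
     \<lparr>P_grid = P_grid (x t) + \<epsilon> * (if 0 < P_grid (x t) then a t - b t else 0),
      P_ch = P_ch (x t) + \<epsilon> * a t,
      P_dis = P_dis (x t) + \<epsilon> * b t,
      P_curt = P_curt (x t) + \<epsilon> * (if 0 < P_grid (x t) then 0 else b t - a t)\<rparr>)"

text \<open>The bound is sharp enough for all constraints: the state at
  \<open>Suc (horizon d)\<close> still reads only decisions inside the index set, beyond which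
  \<open>shift\<close> is undefined.\<close>

lemma soc_shift:
  "t \<le> Suc (horizon d) \<Longrightarrow>
   soc d (shift d x a b \<epsilon>) t = soc d x t + \<epsilon> * (time_step d * net_flow d a b t)"
proof (induction t)
  case 0
  then show ?case by (simp add: net_flow_def)
next
  case (Suc t)
  then show ?case
    by (cases "t = 0") (auto simp: net_flow_def shift_def algebra_simps)
qed

lemma f_cost_shift:
  "f_cost d (shift d x a b \<epsilon>) = f_cost d x + \<epsilon> * (\<Sum>t = 1..horizon d.
     price d t * (if 0 < P_grid (x t) then a t - b t else 0) + alpha d * a t + beta d * b t)"
  by (simp add: f_cost_def shift_def sum_distrib_left flip: sum.distrib)
    (rule sum.cong, auto simp: algebra_simps)

text \<open>A slack inequality survives small perturbations by continuity; a tight one needs only a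
  slope of the right sign.\<close>

lemma eventually_le_add_mult:
  fixes l p q :: real
  assumes "l \<le> p" "p = l \<Longrightarrow> 0 \<le> q"
  shows "\<forall>\<^sub>F \<epsilon> in at_right 0. l \<le> p + \<epsilon> * q"
proof (cases "p = l")
  case True
  have "\<forall>\<^sub>F \<epsilon>::real in at_right 0. 0 < \<epsilon>"
    by (simp add: eventually_at_right_less)
  then show ?thesis
    by eventually_elim (use True assms in simp)
next
  case False
  have "((\<lambda>\<epsilon>. p + \<epsilon> * q) \<longlongrightarrow> p + 0 * q) (at_right 0)"
    by (intro tendsto_intros)
  with False assms(1) have "\<forall>\<^sub>F \<epsilon> in at_right 0. l < p + \<epsilon> * q"
    by (intro order_tendstoD(1)) auto
  then show ?thesis
    by eventually_elim simp
qed

lemma eventually_add_mult_le: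
  fixes u p q :: real
  assumes "p \<le> u" "p = u \<Longrightarrow> q \<le> 0"
  shows "\<forall>\<^sub>F \<epsilon> in at_right 0. p + \<epsilon> * q \<le> u"
  using eventually_le_add_mult[of "- u" "- p" "- q"] assms by (simp add: algebra_simps)

text \<open>The hypotheses are the slope conditions at the tight constraints. Since \<open>a\<close>
  and \<open>b\<close> are nonpositive, the upper power limits are safe, and a nonnegative
  \<open>net_flow\<close> keeps the states above \<open>E_min d\<close>.\<close>

lemma eventually_feasible_shift:
  assumes x: "feasible d x" and dt: "0 < time_step d"
    and ch: "\<And>t. t \<in> {1..horizon d} \<Longrightarrow> a t \<le> 0 \<and> (a t < 0 \<longrightarrow> 0 < P_ch (x t))"
    and dis: "\<And>t. t \<in> {1..horizon d} \<Longrightarrow> b t \<le> 0 \<and> (b t < 0 \<longrightarrow> 0 < P_dis (x t))"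
    and absorb: "\<And>t. t \<in> {1..horizon d} \<Longrightarrow> a t \<le> b t \<and> (a t < b t \<longrightarrow> can_absorb d x t)"
    and soc: "\<And>t. t \<in> {1..horizon d} \<Longrightarrow> 0 \<le> net_flow d a b (Suc t) \<and>
      (0 < net_flow d a b (Suc t) \<longrightarrow> soc d x (Suc t) < E_max d)"
  shows "\<forall>\<^sub>F \<epsilon> in at_right 0. feasible d (shift d x a b \<epsilon>)"
proof -
  let ?dg = "\<lambda>t. if 0 < P_grid (x t) then a t - b t else 0"
  let ?dc = "\<lambda>t. if 0 < P_grid (x t) then 0 else b t - a t"
  let ?w = "\<lambda>t. time_step d * net_flow d a b (Suc t)"
  let ?ok = "\<lambda>\<epsilon> t. 0 \<le> P_grid (x t) + \<epsilon> * ?dg t \<and>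
     0 \<le> P_ch (x t) + \<epsilon> * a t \<and> P_ch (x t) + \<epsilon> * a t \<le> ch_max d \<and>
     0 \<le> P_dis (x t) + \<epsilon> * b t \<and> P_dis (x t) + \<epsilon> * b t \<le> dis_max d \<and>
     E_min d \<le> soc d x (Suc t) + \<epsilon> * ?w t \<and> soc d x (Suc t) + \<epsilon> * ?w t \<le> E_max d \<and>
     0 \<le> P_curt (x t) + \<epsilon> * ?dc t \<and> P_curt (x t) + \<epsilon> * ?dc t \<le> solar d t"
  have "\<forall>\<^sub>F \<epsilon> in at_right 0. ?ok \<epsilon> t" if t: "t \<in> {1..horizon d}" for t
  proof -
    have "0 \<le> P_grid (x t)" "0 \<le> P_ch (x t)" "P_ch (x t) \<le> ch_max d"
      "0 \<le> P_dis (x t)" "P_dis (x t) \<le> dis_max d"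
      "E_min d \<le> soc d x (Suc t)" "soc d x (Suc t) \<le> E_max d"
      "0 \<le> P_curt (x t)" "P_curt (x t) \<le> solar d t"
      using x t by (auto simp: feasible_def simp del: soc.simps)
    moreover have "0 \<le> ?w t"
      using soc[OF t] dt by simp
    moreover have "soc d x (Suc t) = E_max d \<Longrightarrow> ?w t \<le> 0"
      using soc[OF t] by (auto simp: less_le simp del: soc.simps)
    ultimately show ?thesis
      using ch[OF t] dis[OF t] absorb[OF t]
      by (intro eventually_conj eventually_le_add_mult eventually_add_mult_le)
        (auto simp: can_absorb_def not_less simp del: soc.simps)
  qed
  \<comment> \<open>Finitely many times share a common range of step sizes.\<close>
  then have "\<forall>\<^sub>F \<epsilon> in at_right 0. \<forall>t\<in>{1..horizon d}. ?ok \<epsilon> t"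
    by (simp add: eventually_ball_finite)
  then show ?thesis
  proof eventually_elim
    case (elim \<epsilon>)
    show ?case
      unfolding feasible_def
    proof (intro conjI ballI)
      show "shift d x a b \<epsilon> \<in> decision_space d"
        by (simp add: shift_def decision_space_def)
    next
      fix t assume t: "t \<in> {1..horizon d}"
      note ok = bspec[OF elim t]
      show "0 = - P_grid (shift d x a b \<epsilon> t) + load_house d t
          - (solar d t - P_curt (shift d x a b \<epsilon> t))
          - P_dis (shift d x a b \<epsilon> t) + P_ch (shift d x a b \<epsilon> t)"
        using x t by (auto simp: feasible_def shift_def algebra_simps)
      have "soc d (shift d x a b \<epsilon>) (t + 1) = soc d x (Suc t) + \<epsilon> * ?w t"
        using t soc_shift[of "Suc t"] by simp
      then show "E_min d \<le> soc d (shift d x a b \<epsilon>) (t + 1)"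
        "soc d (shift d x a b \<epsilon>) (t + 1) \<le> E_max d"
        using ok by simp_all
    qed (use elim in \<open>auto simp: shift_def\<close>)
  qed
qed

text \<open>Since \<open>a t \<le> b t\<close>, the grid power never rises, so the price terms
  cannot increase the cost; the penalty terms at \<open>u\<close> alone make the decrease
  strict.\<close>

lemma not_arg_min_if_descent:
  assumes x: "feasible d x" and dt: "0 < time_step d"
    and "0 \<le> alpha d" "0 \<le> beta d" and price: "\<forall>t\<in>{1..horizon d}. 0 < price d t"
    and ch: "\<And>t. t \<in> {1..horizon d} \<Longrightarrow> a t \<le> 0 \<and> (a t < 0 \<longrightarrow> 0 < P_ch (x t))"
    and dis: "\<And>t. t \<in> {1..horizon d} \<Longrightarrow> b t \<le> 0 \<and> (b t < 0 \<longrightarrow> 0 < P_dis (x t))"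
    and absorb: "\<And>t. t \<in> {1..horizon d} \<Longrightarrow> a t \<le> b t \<and> (a t < b t \<longrightarrow> can_absorb d x t)"
    and soc: "\<And>t. t \<in> {1..horizon d} \<Longrightarrow> 0 \<le> net_flow d a b (Suc t) \<and>
      (0 < net_flow d a b (Suc t) \<longrightarrow> soc d x (Suc t) < E_max d)"
    and strict: "u \<in> {1..horizon d}" "alpha d * a u + beta d * b u < 0"
  shows "\<not> is_arg_min (f_cost d) (feasible d) x"
proof -
  let ?dg = "\<lambda>t. if 0 < P_grid (x t) then a t - b t else 0"
  let ?df = "\<lambda>t. price d t * ?dg t + alpha d * a t + beta d * b t"
  have le: "?df t \<le> alpha d * a t + beta d * b t" "alpha d * a t + beta d * b t \<le> 0"
    if t: "t \<in> {1..horizon d}" for t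
  proof -
    have "price d t * ?dg t \<le> 0"
      using bspec[OF price t] absorb[OF t] by (intro mult_nonneg_nonpos) auto
    then show "?df t \<le> alpha d * a t + beta d * b t" by simp
    show "alpha d * a t + beta d * b t \<le> 0"
      using assms(3,4) ch[OF t] dis[OF t] by (simp add: add_nonpos_nonpos mult_nonneg_nonpos)
  qed
  have "sum ?df {1..horizon d} < (\<Sum>t = 1..horizon d. 0)"
  proof (rule sum_strict_mono_ex1)
    show "\<forall>t\<in>{1..horizon d}. ?df t \<le> 0"
      using le by (meson order_trans)
    show "\<exists>t\<in>{1..horizon d}. ?df t < 0"
      using le(1)[OF strict(1)] strict by (meson order_le_less_trans)
  qed simp
  then have neg: "sum ?df {1..horizon d} < 0"
    by simp
  have "\<forall>\<^sub>F \<epsilon> in at_right 0. feasible d (shift d x a b \<epsilon>)"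
    using x dt ch dis absorb soc by (rule eventually_feasible_shift)
  moreover have "\<forall>\<^sub>F \<epsilon>::real in at_right 0. 0 < \<epsilon>"
    by (simp add: eventually_at_right_less)
  ultimately have "\<forall>\<^sub>F \<epsilon> in at_right 0. 0 < \<epsilon> \<and> feasible d (shift d x a b \<epsilon>)"
    by (simp add: eventually_conj_iff)
  then obtain \<epsilon> where "0 < \<epsilon>" "feasible d (shift d x a b \<epsilon>)"
    using eventually_happens trivial_limit_at_right_real by blast
  moreover have "f_cost d (shift d x a b \<epsilon>) < f_cost d x"
    using \<open>0 < \<epsilon>\<close> neg by (simp add: f_cost_shift mult_pos_neg)
  ultimately show ?thesis
    by (auto simp: is_arg_min_def)
qed

lemma net_flow_single:
  assumes "1 \<le> t"
  shows "net_flow d (\<lambda>r. if r = t then p else 0) (\<lambda>r. if r = t then q else 0) n =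
    (if t < n then eta_c d * p - eta_d d * q else 0)"
proof -
  have "net_flow d (\<lambda>r. if r = t then p else 0) (\<lambda>r. if r = t then q else 0) n =
      (\<Sum>r = 1..<n. if r = t then eta_c d * p - eta_d d * q else 0)"
    unfolding net_flow_def by (rule sum.cong) auto
  then show ?thesis
    using assms by simp
qed

lemma net_flow_add:
  "net_flow d (\<lambda>r. a r + a' r) (\<lambda>r. b r + b' r) n = net_flow d a b n + net_flow d a' b' n"
  by (simp add: net_flow_def algebra_simps sum.distrib sum_subtractf)

text \<open>With no grid power and all solar power curtailed, the balance leaves the storage as the
  only source for the load and for its own charging.\<close>

lemma discharge_ge_charge_if_not_absorb:
  assumes "feasible d x" "t \<in> {1..horizon d}" "0 \<le> load_house d t" "\<not> can_absorb d x t"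
  shows "P_ch (x t) \<le> P_dis (x t)"
proof -
  have "0 = - P_grid (x t) + load_house d t - (solar d t - P_curt (x t)) - P_dis (x t) + P_ch (x t)"
    using assms(1,2) by (simp add: feasible_def)
  with assms(3,4) show ?thesis
    by (simp add: can_absorb_def)
qed

text \<open>Conversion losses: discharging a unit drains \<open>eta_d d\<close>, while charging one
  stores only \<open>eta_c d\<close>.\<close>

lemma soc_le_if_discharge_ge_charge:
  assumes "0 < time_step d" "0 < eta_c d" "eta_c d < eta_d d" "1 \<le> t"
    and "0 \<le> P_ch (x t)" "P_ch (x t) \<le> P_dis (x t)"
  shows "soc d x (Suc t) \<le> soc d x t"
    and "0 < P_dis (x t) \<Longrightarrow> soc d x (Suc t) < soc d x t"
proof -
  have step: "soc d x (Suc t) =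
      soc d x t + time_step d * (eta_c d * P_ch (x t) - eta_d d * P_dis (x t))"
    using assms(4) by (simp add: algebra_simps)
  have c: "eta_c d * P_ch (x t) \<le> eta_c d * P_dis (x t)"
    using assms by simp
  have "eta_c d * P_dis (x t) \<le> eta_d d * P_dis (x t)"
    using assms by (intro mult_right_mono) auto
  with c have "time_step d * (eta_c d * P_ch (x t) - eta_d d * P_dis (x t)) \<le> 0"
    using assms(1) by (intro mult_nonneg_nonpos) auto
  then show "soc d x (Suc t) \<le> soc d x t"
    using step by simp
  assume "0 < P_dis (x t)"
  then have "eta_c d * P_dis (x t) < eta_d d * P_dis (x t)"
    using assms by simp
  with c have "time_step d * (eta_c d * P_ch (x t) - eta_d d * P_dis (x t)) < 0"
    using assms(1) by (intro mult_pos_neg) auto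
  then show "soc d x (Suc t) < soc d x t"
    using step by simp
qed

theorem proposition1:
  fixes d :: ess_data and x :: "nat \<Rightarrow> decision"
  assumes "standing_assms d"
    and "0 \<le> alpha d" and "0 \<le> beta d" and "0 < alpha d + beta d"
    and "0 < eta_c d" and "eta_c d < 1" and "1 < eta_d d"
    and "\<forall>t\<in>{1..horizon d}. 0 < price d t"
    and "feasible d x"
    and "\<exists>t\<in>{1..horizon d}.
           0 < P_ch (x t) \<and> P_ch (x t) \<le> ch_max d \<and>
           0 < P_dis (x t) \<and> P_dis (x t) \<le> dis_max d"
  shows "\<not> is_arg_min (f_cost d) (feasible d) x"
proof -
  have dt: "0 < time_step d"
    and load: "\<And>t. t \<in> {1..horizon d} \<Longrightarrow> 0 \<le> load_house d t"
    using assms(1) by (auto simp: standing_assms_def)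
  have eta: "0 < eta_c d" "eta_c d < eta_d d"
    using assms(5-7) by auto
  have nonneg: "0 \<le> P_ch (x r)" "0 \<le> P_dis (x r)" "soc d x (Suc r) \<le> E_max d"
    if "r \<in> {1..horizon d}" for r
    using assms(9) that by (auto simp: feasible_def simp del: soc.simps)
  from assms(10) obtain t where t: "t \<in> {1..horizon d}" "0 < P_ch (x t)" "0 < P_dis (x t)"
    by blast
  note descent = not_arg_min_if_descent[OF assms(9) dt assms(2,3,8) _ _ _ _ t(1)]
  show ?thesis
  proof (cases "can_absorb d x t")
    case True
    have "alpha d * (- eta_d d) + beta d * (- eta_c d) < 0"
    proof (cases "alpha d = 0")
      case True
      then show ?thesis using assms(4) eta by simp
    next
      case False
      then have "0 < alpha d * eta_d d" "0 \<le> beta d * eta_c d"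
        using assms(2,3) eta by simp_all
      then show ?thesis by simp
    qed
    \<comment> \<open>The two flows \<open>eta_c d * eta_d d\<close> cancel, so
      \<open>net_flow\<close> vanishes at all times.\<close>
    with True t eta show ?thesis
      by (intro descent[of "\<lambda>r. if r = t then - eta_d d else 0" "\<lambda>r. if r = t then - eta_c d else 0"])
        (auto simp: net_flow_single simp del: soc.simps)
  next
    case False
    \<comment> \<open>Feasibility bounds only the states at the ends of steps, so the initial state
      needs the standing assumptions.\<close>
    have soc_t: "soc d x t \<le> E_max d"
    proof (cases "t = 1")
      case True
      then show ?thesis using assms(1) by (simp add: standing_assms_def)
    next
      case False
      then have "t - 1 \<in> {1..horizon d}" "Suc (t - 1) = t"
        using t(1) by auto
      then show ?thesis using nonneg(3)[of "t - 1"] by (simp del: soc.simps)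
    qed
    have "P_ch (x t) \<le> P_dis (x t)"
      using assms(9) t(1) load False by (intro discharge_ge_charge_if_not_absorb)
    then have "soc d x (Suc t) < soc d x t"
      using dt eta t by (intro soc_le_if_discharge_ge_charge(2)) auto
    with soc_t have drop: "soc d x (Suc t) < E_max d"
      by simp
    let ?full = "\<lambda>s. t \<le> s \<and> s \<le> horizon d \<and> soc d x (Suc s) = E_max d"
    show ?thesis
    proof (cases "\<exists>s. ?full s")
      case no_full: False
      have "soc d x (Suc r) < E_max d" if "t \<le> r" "r \<le> horizon d" for r
        using no_full that nonneg(3)[of r] t(1) by (auto simp: less_le simp del: soc.simps)
      \<comment> \<open>Equal reductions leave the power balance at \<open>t\<close> intact, so
        nothing has to be absorbed there.\<close>
      with t eta assms(4) show ?thesis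
        by (intro descent[of "\<lambda>r. if r = t then - 1 else 0" "\<lambda>r. if r = t then - 1 else 0"])
          (auto simp: net_flow_single simp del: soc.simps)
    next
      case True
      define s where "s = (LEAST s. ?full s)"
      have s: "?full s"
        unfolding s_def using True by (rule LeastI_ex)
      with drop have "t < s"
        by (cases "t = s") (auto simp del: soc.simps)
      then have sN: "s \<in> {1..horizon d}"
        using s t(1) by (auto simp del: soc.simps)
      have before: "soc d x (Suc r) < E_max d" if "t \<le> r" "r < s" for r
      proof -
        have "soc d x (Suc r) \<noteq> E_max d"
          using not_less_Least[of r ?full] that s unfolding s_def[symmetric]
          by (auto simp del: soc.simps)
        then show ?thesis
          using nonneg(3)[of r] that s t(1) by (auto simp: less_le simp del: soc.simps)
      qed
      \<comment> \<open>By minimality of \<open>s\<close> the storage is not yet full when step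
        \<open>s\<close> starts.\<close>
      have "soc d x s < soc d x (Suc s)"
        using before[of "s - 1"] \<open>t < s\<close> s by (simp del: soc.simps)
      then have charge: "P_dis (x s) < P_ch (x s)"
        using soc_le_if_discharge_ge_charge(1)[OF dt eta, of s x] nonneg[OF sN] sN
        by (force simp del: soc.simps)
      then have absorb: "can_absorb d x s"
        using discharge_ge_charge_if_not_absorb[OF assms(9) sN load[OF sN]] by linarith
      \<comment> \<open>Charging \<open>k\<close> less at \<open>s\<close> cancels the surplus
        \<open>eta_d d - eta_c d\<close> gained at \<open>t\<close>, so \<open>net_flow\<close> is
        positive only at the times \<open>n\<close> with \<open>t < n \<le> s\<close>, where the
        storage is not full.\<close>
      define k where "k = (eta_d d - eta_c d) / eta_c d"
      have k: "0 < k" "eta_c d * k = eta_d d - eta_c d"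
        using eta by (auto simp: k_def)
      let ?a = "\<lambda>r. (if r = t then - 1 else 0) + (if r = s then - k else 0)"
      \<comment> \<open>Discharging at \<open>s\<close> stays fixed, as it may be zero there; the
        balance at \<open>s\<close> thus has to absorb \<open>k\<close>.\<close>
      let ?b = "\<lambda>r. if r = t then - 1 else 0 :: real"
      have flow: "net_flow d ?a ?b n = (if t < n \<and> n \<le> s then eta_d d - eta_c d else 0)" for n
        using net_flow_add[of d "\<lambda>r. if r = t then - 1 else 0" "\<lambda>r. if r = s then - k else 0" ?b "\<lambda>_. 0" n]
          net_flow_single[of t d "- 1" "- 1" n] net_flow_single[of s d "- k" 0 n]
          t(1) sN \<open>t < s\<close> k(2) by auto
      show ?thesis
      proof (rule descent[of ?a ?b])
        fix r assume r: "r \<in> {1..horizon d}"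
        show "?a r \<le> 0 \<and> (?a r < 0 \<longrightarrow> 0 < P_ch (x r))"
          using k(1) t charge nonneg(2)[OF sN] by auto
        show "?b r \<le> 0 \<and> (?b r < 0 \<longrightarrow> 0 < P_dis (x r))"
          using t by auto
        show "?a r \<le> ?b r \<and> (?a r < ?b r \<longrightarrow> can_absorb d x r)"
          using k(1) absorb by auto
        show "0 \<le> net_flow d ?a ?b (Suc r) \<and>
            (0 < net_flow d ?a ?b (Suc r) \<longrightarrow> soc d x (Suc r) < E_max d)"
          unfolding flow using before[of r] eta by (auto simp del: soc.simps)
      next
        show "alpha d * ?a t + beta d * ?b t < 0"
          using assms(4) \<open>t < s\<close> by simp
      qed
    qed
  qed
qed

end
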